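(* Let $(M,\varphi,\xi,\eta,g)$ be an almost cosymplectic manifold with Kähler leaves. Then its fundamental 2-form $\Phi$ is harmonic, i.e. $\Delta\Phi=(d\delta+\delta d)\Phi=0$, where $\delta$ is the codifferential of $g$.
   Context: An almost contact metric manifold $(M,\varphi,\xi,\eta,g)$ has a $(1,1)$-tensor field $\varphi$, a vector field $\xi$, a 1-form $\eta$ and a Riemannian metric $g$ with $\varphi^2=-I+\eta\otimes\xi$, $\eta(\xi)=1$, $g(\varphi X,\varphi Y)=g(X,Y)-\eta(X)\eta(Y)$; its fundamental 2-form is $\Phi(X,Y)=g(X,\varphi Y)$. It is almost cosymplectic if $d\Phi=0$ and $d\eta=0$. Then the distribution $D=\ker\eta$ is integrable and its leaves (maximal integral hypersurfaces), with the induced metric and the almost complex structure $\varphi|_D$, are almost Kähler; $M$ is said to have Kähler leaves if all these leaves are Kähler manifolds. *)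

theory Defs
  imports "HOL-Analysis.Analysis"
begin

text \<open>
  Conventions. A manifold is a topology with an atlas whose charts map onto relatively open subsets
  of a fixed linear subspace \<open>H\<close> of a Euclidean space, so its dimension is \<open>dim H\<close>. The ambient
  manifold uses \<open>H = UNIV\<close>; its hypersurfaces use a hyperplane \<open>H\<close> of the same space, which covers
  every dimension, including leaves of dimension zero. A tensor field is the family of its local
  representatives: for each chart, a function of the coordinate point and of tangent vectors
  written in the coordinates of that chart. Values of a representative off the chart image, or on
  vectors outside \<open>H\<close>, carry no meaning and are never constrained.
\<close>

section \<open>Smooth maps and smooth manifolds\<close>

definition dderiv :: "('e::real_normed_vector \<Rightarrow> 'b::real_normed_vector) \<Rightarrow> 'e \<Rightarrow> 'e \<Rightarrow> 'b" where
  "dderiv f x u = vector_derivative (\<lambda>t. f (x + t *\<^sub>R u)) (at 0)"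

text \<open>For \<open>S\<close> open in the subspace \<open>H\<close>: being of class \<open>C\<^sup>k\<close> along \<open>H\<close>.\<close>

primrec k_smooth_on ::
  "nat \<Rightarrow> 'e::euclidean_space set \<Rightarrow> 'e set \<Rightarrow> ('e \<Rightarrow> 'b::real_normed_vector) \<Rightarrow> bool" where
  "k_smooth_on 0 H S f \<longleftrightarrow> continuous_on S f"
| "k_smooth_on (Suc k) H S f \<longleftrightarrow>
     f differentiable_on S \<and> (\<forall>u\<in>H. k_smooth_on k H S (\<lambda>x. dderiv f x u))"

definition smooth_on ::
  "'e::euclidean_space set \<Rightarrow> 'e set \<Rightarrow> ('e \<Rightarrow> 'b::real_normed_vector) \<Rightarrow> bool" where
  "smooth_on H S f \<longleftrightarrow> (\<forall>k. k_smooth_on k H S f)"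

type_synonym ('a, 'e) chart = "'a set \<times> ('a \<Rightarrow> 'e)"

definition chart_image :: "('a, 'e) chart \<Rightarrow> 'e set" where
  "chart_image c = snd c ` fst c"

text \<open>
  The coordinate expression, from the chart \<open>b\<close> to the chart \<open>c\<close>, of the identity map. If \<open>b\<close> is a
  chart of a submanifold and \<open>c\<close> a chart of the ambient manifold, it expresses the inclusion.
\<close>

definition transition :: "('a, 'e) chart \<Rightarrow> ('a, 'e) chart \<Rightarrow> 'e \<Rightarrow> 'e" where
  "transition b c = snd c \<circ> inv_into (fst b) (snd b)"

definition chart_deriv ::
  "('a, 'e::euclidean_space) chart \<Rightarrow> ('a, 'e) chart \<Rightarrow> 'a \<Rightarrow> 'e \<Rightarrow> 'e" where
  "chart_deriv b c p = dderiv (transition b c) (snd b p)"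

text \<open>
  Second countability is not included: it is required separately of the ambient manifold, and then
  holds automatically for its leaves.
\<close>

definition smooth_manifold ::
  "'a topology \<Rightarrow> 'e::euclidean_space set \<Rightarrow> ('a, 'e) chart set \<Rightarrow> bool" where
  "smooth_manifold T H A \<longleftrightarrow>
     Hausdorff_space T \<and> subspace H \<and> (\<Union>c\<in>A. fst c) = topspace T \<and>
     (\<forall>c\<in>A. openin T (fst c) \<and> openin (top_of_set H) (chart_image c) \<and>
        homeomorphic_map (subtopology T (fst c)) (top_of_set (chart_image c)) (snd c)) \<and>
     (\<forall>b\<in>A. \<forall>c\<in>A. smooth_on H (snd b ` (fst b \<inter> fst c)) (transition b c))"

section \<open>Tensor fields\<close>

type_synonym ('a, 'e) vector_fam = "('a, 'e) chart \<Rightarrow> 'e \<Rightarrow> 'e"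
type_synonym ('a, 'e) covector_fam = "('a, 'e) chart \<Rightarrow> 'e \<Rightarrow> 'e \<Rightarrow> real"
type_synonym ('a, 'e) endo_fam = "('a, 'e) chart \<Rightarrow> 'e \<Rightarrow> 'e \<Rightarrow> 'e"
type_synonym ('a, 'e) metric_fam = "('a, 'e) chart \<Rightarrow> 'e \<Rightarrow> 'e \<Rightarrow> 'e \<Rightarrow> real"

definition linear_over ::
  "'e::real_vector set \<Rightarrow> ('e \<Rightarrow> 'b::real_vector) \<Rightarrow> bool" where
  "linear_over H f \<longleftrightarrow> (\<forall>u\<in>H. \<forall>v\<in>H. \<forall>r s. f (r *\<^sub>R u + s *\<^sub>R v) = r *\<^sub>R f u + s *\<^sub>R f v)"

text \<open>
  The next two relations say that the representatives on the charts in \<open>B\<close> (with model \<open>H\<close>) and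
  those on the charts in \<open>A\<close> correspond under the map expressed by the transitions. With \<open>B = A\<close> this is the
  transformation law of a tensor field; for \<open>B\<close> an atlas of a submanifold it says that the former
  is induced by the latter, the endomorphism preserving the tangent spaces of the submanifold.
\<close>

definition induced_metric ::
  "'e::euclidean_space set \<Rightarrow> ('a, 'e) chart set \<Rightarrow> ('a, 'e) metric_fam \<Rightarrow>
   ('a, 'e) chart set \<Rightarrow> ('a, 'e) metric_fam \<Rightarrow> bool" where
  "induced_metric H B h A g \<longleftrightarrow>
     (\<forall>b\<in>B. \<forall>c\<in>A. \<forall>p\<in>fst b \<inter> fst c. \<forall>u\<in>H. \<forall>v\<in>H.
        h b (snd b p) u v = g c (snd c p) (chart_deriv b c p u) (chart_deriv b c p v))"

definition induced_endo ::
  "'e::euclidean_space set \<Rightarrow> ('a, 'e) chart set \<Rightarrow> ('a, 'e) endo_fam \<Rightarrow>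
   ('a, 'e) chart set \<Rightarrow> ('a, 'e) endo_fam \<Rightarrow> bool" where
  "induced_endo H B J A \<phi> \<longleftrightarrow>
     (\<forall>b\<in>B. \<forall>c\<in>A. \<forall>p\<in>fst b \<inter> fst c. \<forall>u\<in>H.
        J b (snd b p) u \<in> H \<and>
        chart_deriv b c p (J b (snd b p) u) = \<phi> c (snd c p) (chart_deriv b c p u))"

definition vector_field ::
  "'e::euclidean_space set \<Rightarrow> ('a, 'e) chart set \<Rightarrow> ('a, 'e) vector_fam \<Rightarrow> bool" where
  "vector_field H A X \<longleftrightarrow>
     (\<forall>c\<in>A. (\<forall>x\<in>chart_image c. X c x \<in> H) \<and> smooth_on H (chart_image c) (X c)) \<and>
     (\<forall>b\<in>A. \<forall>c\<in>A. \<forall>p\<in>fst b \<inter> fst c. X c (snd c p) = chart_deriv b c p (X b (snd b p)))"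

definition one_form ::
  "'e::euclidean_space set \<Rightarrow> ('a, 'e) chart set \<Rightarrow> ('a, 'e) covector_fam \<Rightarrow> bool" where
  "one_form H A \<eta> \<longleftrightarrow>
     (\<forall>c\<in>A. (\<forall>x\<in>chart_image c. linear_over H (\<eta> c x)) \<and>
            (\<forall>u\<in>H. smooth_on H (chart_image c) (\<lambda>x. \<eta> c x u))) \<and>
     (\<forall>b\<in>A. \<forall>c\<in>A. \<forall>p\<in>fst b \<inter> fst c. \<forall>u\<in>H.
        \<eta> b (snd b p) u = \<eta> c (snd c p) (chart_deriv b c p u))"

definition endo_field ::
  "'e::euclidean_space set \<Rightarrow> ('a, 'e) chart set \<Rightarrow> ('a, 'e) endo_fam \<Rightarrow> bool" where
  "endo_field H A \<phi> \<longleftrightarrow>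
     (\<forall>c\<in>A. (\<forall>x\<in>chart_image c. linear_over H (\<phi> c x) \<and> \<phi> c x ` H \<subseteq> H) \<and>
            (\<forall>u\<in>H. smooth_on H (chart_image c) (\<lambda>x. \<phi> c x u))) \<and>
     induced_endo H A \<phi> A \<phi>"

definition riemannian_metric ::
  "'e::euclidean_space set \<Rightarrow> ('a, 'e) chart set \<Rightarrow> ('a, 'e) metric_fam \<Rightarrow> bool" where
  "riemannian_metric H A g \<longleftrightarrow>
     (\<forall>c\<in>A. (\<forall>x\<in>chart_image c. \<forall>u\<in>H.
               linear_over H (g c x u) \<and> (\<forall>v\<in>H. g c x u v = g c x v u) \<and>
               (u \<noteq> 0 \<longrightarrow> g c x u u > 0)) \<and>
            (\<forall>u\<in>H. \<forall>v\<in>H. smooth_on H (chart_image c) (\<lambda>x. g c x u v))) \<and>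
     induced_metric H A g A g"

section \<open>Differential forms in coordinates\<close>

text \<open>
  A local representative of a \<open>k\<close>-form sends a point and a list of \<open>k\<close> tangent vectors to a real.
  All vector arguments below are constant in the chart, so brackets of coordinate fields vanish and
  the invariant formulas reduce to those stated.
\<close>

type_synonym 'e form = "'e \<Rightarrow> 'e list \<Rightarrow> real"

definition ext_deriv :: "'e::euclidean_space form \<Rightarrow> 'e form" where
  "ext_deriv \<omega> x vs =
     (\<Sum>i<length vs. (- 1) ^ i * dderiv (\<lambda>y. \<omega> y (take i vs @ drop (Suc i) vs)) x (vs ! i))"

text \<open>
  The Levi-Civita connection \<open>\<nabla>\<^sub>u v\<close> of a metric representative on an open subset of the whole space, for
  constant fields \<open>u\<close>, \<open>v\<close>, by the Koszul formula.
\<close>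

definition christoffel ::
  "('e::euclidean_space \<Rightarrow> 'e \<Rightarrow> 'e \<Rightarrow> real) \<Rightarrow> 'e \<Rightarrow> 'e \<Rightarrow> 'e \<Rightarrow> 'e" where
  "christoffel g x u v = (THE w. \<forall>z.
     2 * g x w z =
       dderiv (\<lambda>y. g y v z) x u + dderiv (\<lambda>y. g y u z) x v - dderiv (\<lambda>y. g y u v) x z)"

definition cov_deriv ::
  "('e::euclidean_space \<Rightarrow> 'e \<Rightarrow> 'e \<Rightarrow> real) \<Rightarrow> 'e form \<Rightarrow> 'e \<Rightarrow> 'e \<Rightarrow> 'e list \<Rightarrow> real" where
  "cov_deriv g \<omega> x u vs =
     dderiv (\<lambda>y. \<omega> y vs) x u -
     (\<Sum>i<length vs. \<omega> x (vs[i := christoffel g x u (vs ! i)]))"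

definition orthonormal_basis :: "('e::euclidean_space \<Rightarrow> 'e \<Rightarrow> real) \<Rightarrow> 'e set \<Rightarrow> bool" where
  "orthonormal_basis G E \<longleftrightarrow>
     finite E \<and> span E = UNIV \<and> (\<forall>e\<in>E. \<forall>f\<in>E. G e f = (if e = f then 1 else 0))"

text \<open>
  The codifferential \<open>\<delta>\<omega> = - \<Sum>\<^sub>e (\<nabla>\<^sub>e \<omega>)(e, \<dots>)\<close>; the trace does not depend on the orthonormal basis.
\<close>

definition codiff ::
  "('e::euclidean_space \<Rightarrow> 'e \<Rightarrow> 'e \<Rightarrow> real) \<Rightarrow> 'e form \<Rightarrow> 'e form" where
  "codiff g \<omega> x vs =
     - (\<Sum>e\<in>(SOME E. orthonormal_basis (g x) E). cov_deriv g \<omega> x e (e # vs))"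

definition hodge_laplacian ::
  "('e::euclidean_space \<Rightarrow> 'e \<Rightarrow> 'e \<Rightarrow> real) \<Rightarrow> 'e form \<Rightarrow> 'e form" where
  "hodge_laplacian g \<omega> x vs = ext_deriv (codiff g \<omega>) x vs + codiff g (ext_deriv \<omega>) x vs"

definition closed_form ::
  "'e::euclidean_space set \<Rightarrow> ('a, 'e) chart set \<Rightarrow> nat \<Rightarrow> (('a, 'e) chart \<Rightarrow> 'e form) \<Rightarrow> bool" where
  "closed_form H A k \<omega> \<longleftrightarrow>
     (\<forall>c\<in>A. \<forall>x\<in>chart_image c. \<forall>vs. length vs = Suc k \<and> set vs \<subseteq> H \<longrightarrow> ext_deriv (\<omega> c) x vs = 0)"

definition harmonic_form ::
  "('a, 'e::euclidean_space) chart set \<Rightarrow> ('a, 'e) metric_fam \<Rightarrow> nat \<Rightarrow>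
   (('a, 'e) chart \<Rightarrow> 'e form) \<Rightarrow> bool" where
  "harmonic_form A g k \<omega> \<longleftrightarrow>
     (\<forall>c\<in>A. \<forall>x\<in>chart_image c. \<forall>vs. length vs = k \<longrightarrow> hodge_laplacian (g c) (\<omega> c) x vs = 0)"

definition form_of_covector :: "('a, 'e) covector_fam \<Rightarrow> ('a, 'e) chart \<Rightarrow> 'e form" where
  "form_of_covector \<eta> c x vs = \<eta> c x (vs ! 0)"

definition fundamental_form ::
  "('a, 'e) metric_fam \<Rightarrow> ('a, 'e) endo_fam \<Rightarrow> ('a, 'e) chart \<Rightarrow> 'e form" where
  "fundamental_form g \<phi> c x vs = g c x (vs ! 0) (\<phi> c x (vs ! 1))"

section \<open>Kaehler manifolds\<close>

definition almost_hermitian_manifold ::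
  "'a topology \<Rightarrow> 'e::euclidean_space set \<Rightarrow> ('a, 'e) chart set \<Rightarrow>
   ('a, 'e) endo_fam \<Rightarrow> ('a, 'e) metric_fam \<Rightarrow> bool" where
  "almost_hermitian_manifold T H A J g \<longleftrightarrow>
     smooth_manifold T H A \<and> endo_field H A J \<and> riemannian_metric H A g \<and>
     (\<forall>c\<in>A. \<forall>x\<in>chart_image c. \<forall>u\<in>H.
        J c x (J c x u) = - u \<and> (\<forall>v\<in>H. g c x (J c x u) (J c x v) = g c x u v))"

definition almost_kaehler_manifold ::
  "'a topology \<Rightarrow> 'e::euclidean_space set \<Rightarrow> ('a, 'e) chart set \<Rightarrow>
   ('a, 'e) endo_fam \<Rightarrow> ('a, 'e) metric_fam \<Rightarrow> bool" where
  "almost_kaehler_manifold T H A J g \<longleftrightarrow>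
     almost_hermitian_manifold T H A J g \<and> closed_form H A 2 (fundamental_form g J)"

definition lie_bracket ::
  "('e::euclidean_space \<Rightarrow> 'e) \<Rightarrow> ('e \<Rightarrow> 'e) \<Rightarrow> 'e \<Rightarrow> 'e" where
  "lie_bracket X Y x = dderiv Y x (X x) - dderiv X x (Y x)"

definition nijenhuis ::
  "('e::euclidean_space \<Rightarrow> 'e \<Rightarrow> 'e) \<Rightarrow> ('e \<Rightarrow> 'e) \<Rightarrow> ('e \<Rightarrow> 'e) \<Rightarrow> 'e \<Rightarrow> 'e" where
  "nijenhuis J X Y x =
     J x (J x (lie_bracket X Y x)) + lie_bracket (\<lambda>y. J y (X y)) (\<lambda>y. J y (Y y)) x
     - J x (lie_bracket (\<lambda>y. J y (X y)) Y x) - J x (lie_bracket X (\<lambda>y. J y (Y y)) x)"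

text \<open>
  Kaehler means almost Kaehler with integrable almost complex structure. As the Nijenhuis bracket is a
  tensor, it vanishes as soon as it does so on constant fields.
\<close>

definition kaehler_manifold ::
  "'a topology \<Rightarrow> 'e::euclidean_space set \<Rightarrow> ('a, 'e) chart set \<Rightarrow>
   ('a, 'e) endo_fam \<Rightarrow> ('a, 'e) metric_fam \<Rightarrow> bool" where
  "kaehler_manifold T H A J g \<longleftrightarrow>
     almost_kaehler_manifold T H A J g \<and>
     (\<forall>c\<in>A. \<forall>x\<in>chart_image c. \<forall>u\<in>H. \<forall>v\<in>H. nijenhuis (J c) (\<lambda>_. u) (\<lambda>_. v) x = 0)"

section \<open>Almost cosymplectic manifolds and their leaves\<close>

definition almost_contact_metric_manifold ::
  "'a topology \<Rightarrow> ('a, 'e::euclidean_space) chart set \<Rightarrow> ('a, 'e) endo_fam \<Rightarrow>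
   ('a, 'e) vector_fam \<Rightarrow> ('a, 'e) covector_fam \<Rightarrow> ('a, 'e) metric_fam \<Rightarrow> bool" where
  "almost_contact_metric_manifold T A \<phi> \<xi> \<eta> g \<longleftrightarrow>
     smooth_manifold T UNIV A \<and> second_countable T \<and>
     endo_field UNIV A \<phi> \<and> vector_field UNIV A \<xi> \<and> one_form UNIV A \<eta> \<and>
     riemannian_metric UNIV A g \<and>
     (\<forall>c\<in>A. \<forall>x\<in>chart_image c.
        \<eta> c x (\<xi> c x) = 1 \<and>
        (\<forall>u. \<phi> c x (\<phi> c x u) = - u + \<eta> c x u *\<^sub>R \<xi> c x) \<and>
        (\<forall>u v. g c x (\<phi> c x u) (\<phi> c x v) = g c x u v - \<eta> c x u * \<eta> c x v))"

definition almost_cosymplectic_manifold ::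
  "'a topology \<Rightarrow> ('a, 'e::euclidean_space) chart set \<Rightarrow> ('a, 'e) endo_fam \<Rightarrow>
   ('a, 'e) vector_fam \<Rightarrow> ('a, 'e) covector_fam \<Rightarrow> ('a, 'e) metric_fam \<Rightarrow> bool" where
  "almost_cosymplectic_manifold T A \<phi> \<xi> \<eta> g \<longleftrightarrow>
     almost_contact_metric_manifold T A \<phi> \<xi> \<eta> g \<and>
     closed_form UNIV A 2 (fundamental_form g \<phi>) \<and>
     closed_form UNIV A 1 (form_of_covector \<eta>)"

text \<open>
  A connected integral hypersurface of \<open>D = ker \<eta>\<close>: a connected manifold on a subset of \<open>M\<close>, with its
  own, possibly finer, topology, such that the inclusion is smooth and maps each tangent space onto
  the corresponding space of \<open>D\<close>. The dimensions agree, so the inclusion is an immersion.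
\<close>

definition integral_hypersurface ::
  "'a topology \<Rightarrow> ('a, 'e::euclidean_space) chart set \<Rightarrow> ('a, 'e) covector_fam \<Rightarrow>
   'a topology \<Rightarrow> 'e set \<Rightarrow> ('a, 'e) chart set \<Rightarrow> bool" where
  "integral_hypersurface T A \<eta> S H B \<longleftrightarrow>
     smooth_manifold S H B \<and> dim H + 1 = DIM('e) \<and>
     connected_space S \<and> topspace S \<noteq> {} \<and>
     topspace S \<subseteq> topspace T \<and> continuous_map S T (\<lambda>p. p) \<and>
     (\<forall>b\<in>B. \<forall>c\<in>A.
        smooth_on H (snd b ` (fst b \<inter> fst c)) (transition b c) \<and>
        (\<forall>p\<in>fst b \<inter> fst c. chart_deriv b c p ` H = {v. \<eta> c (snd c p) v = 0}))"

definition leaf ::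
  "'a topology \<Rightarrow> ('a, 'e::euclidean_space) chart set \<Rightarrow> ('a, 'e) covector_fam \<Rightarrow>
   'a topology \<Rightarrow> 'e set \<Rightarrow> ('a, 'e) chart set \<Rightarrow> bool" where
  "leaf T A \<eta> S H B \<longleftrightarrow>
     integral_hypersurface T A \<eta> S H B \<and>
     (\<forall>S' H' B'. integral_hypersurface T A \<eta> S' H' B' \<and> topspace S \<subseteq> topspace S' \<longrightarrow>
        topspace S' = topspace S)"

definition has_kaehler_leaves ::
  "'a topology \<Rightarrow> ('a, 'e::euclidean_space) chart set \<Rightarrow> ('a, 'e) endo_fam \<Rightarrow>
   ('a, 'e) covector_fam \<Rightarrow> ('a, 'e) metric_fam \<Rightarrow> bool" where
  "has_kaehler_leaves T A \<phi> \<eta> g \<longleftrightarrow>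
     (\<forall>S H B J h. leaf T A \<eta> S H B \<and> induced_endo H B J A \<phi> \<and> induced_metric H B h A g \<longrightarrow>
        kaehler_manifold S H B J h)"

end

theory Submission
  imports Defs
begin

text \<open>
  As \<open>\<Phi>\<close> is closed, only \<open>\<delta>\<Phi> = 0\<close> has to be shown. This is a pointwise trace computation with
  \<open>B\<^sub>u = \<nabla>\<^sub>u \<phi>\<close>, for which \<open>(\<nabla>\<^sub>u \<Phi>)(v, w) = g(v, B\<^sub>u w)\<close>, and with \<open>N = \<nabla>\<xi>\<close>, which is symmetric because
  \<open>d\<eta> = 0\<close>. Let \<open>e\<close> run through an orthonormal basis. Inserting \<open>e\<close> and \<open>\<phi> e\<close> into \<open>d\<Phi> = 0\<close>
  gives \<open>\<Sum>\<^sub>e g(\<phi> e, B\<^sub>e v) = 0\<close>; by the derivative of \<open>\<phi>\<^sup>2 = - I + \<eta> \<otimes> \<xi>\<close> this turns into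
  \<open>\<Sum>\<^sub>e g(e, B\<^sub>e (\<phi> v)) = \<eta>(v) div \<xi>\<close>. Taking \<open>v = \<xi>\<close> shows \<open>div \<xi> = 0\<close>, so \<open>\<delta>\<Phi>\<close> vanishes on the image
  of \<open>\<phi>\<close>; on \<open>\<xi>\<close> it vanishes because \<open>B\<^sub>e \<xi> = - \<phi> (N e)\<close> with \<open>\<phi>\<close> skew and \<open>N\<close> symmetric.
\<close>

section \<open>Directional derivatives and the product rule for families of linear maps\<close>

text \<open>\<open>dderiv\<close> only looks along lines, so the chain rule identifies it with the
  Frechet derivative wherever that exists.\<close>

lemma dderiv_eq:
  assumes "(f has_derivative f') (at x)"
  shows "dderiv f x = f'"
proof
  fix u
  have line: "((\<lambda>t. x + t *\<^sub>R u) has_derivative (\<lambda>t. t *\<^sub>R u)) (at (0::real))"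
    by (auto intro!: derivative_eq_intros)
  have "((f \<circ> (\<lambda>t. x + t *\<^sub>R u)) has_derivative f' \<circ> (\<lambda>t. t *\<^sub>R u)) (at 0)"
    by (rule diff_chain_at[OF line]) (use assms in simp)
  moreover have "f' \<circ> (\<lambda>t. t *\<^sub>R u) = (\<lambda>t. t *\<^sub>R f' u)"
    using has_derivative_linear[OF assms] by (auto simp: linear_cmul)
  ultimately have "((\<lambda>t. f (x + t *\<^sub>R u)) has_vector_derivative f' u) (at 0)"
    by (simp add: has_vector_derivative_def o_def)
  then show "dderiv f x u = f' u"
    unfolding dderiv_def by (rule vector_derivative_at)
qed

lemma has_derivative_dderiv:
  assumes "f differentiable at x"
  shows "(f has_derivative dderiv f x) (at x)"
  using assms dderiv_eq unfolding differentiable_def by metis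

lemma dderiv_eq_0:
  assumes "open S" "x \<in> S" and "\<And>y. y \<in> S \<Longrightarrow> f y = 0"
  shows "dderiv f x = (\<lambda>u. 0)"
  by (rule dderiv_eq, rule has_derivative_transform_within_open[OF has_derivative_const assms(1,2)])
     (simp add: assms(3))

text \<open>Additivity and homogeneity of \<open>A y\<close> hold on a neighbourhood of
  \<open>x\<close>, so they may be differentiated there; uniqueness of the derivative carries them
  over to \<open>DA\<close>.\<close>

lemma linear_derivative_linear_family:
  fixes A :: "'e::real_normed_vector \<Rightarrow> 'f::real_vector \<Rightarrow> 'b::real_normed_vector"
  assumes S: "open S" "x \<in> S" and lin: "\<And>y. y \<in> S \<Longrightarrow> linear (A y)"
    and A: "\<And>v. ((\<lambda>y. A y v) has_derivative DA v) (at x)"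
  shows "linear (\<lambda>v. DA v u)"
proof (rule linearI)
  fix v w r
  have "((\<lambda>y. A y (v + w)) has_derivative (\<lambda>u. DA v u + DA w u)) (at x)"
    by (rule has_derivative_transform_within_open[OF has_derivative_add[OF A A] S])
       (simp add: lin linear_add)
  then show "DA (v + w) u = DA v u + DA w u"
    using has_derivative_unique[OF A] by metis
  have "((\<lambda>y. A y (r *\<^sub>R v)) has_derivative (\<lambda>u. r *\<^sub>R DA v u)) (at x)"
    by (rule has_derivative_transform_within_open[OF has_derivative_scaleR_right[OF A] S])
       (simp add: lin linear_cmul)
  then show "DA (r *\<^sub>R v) u = r *\<^sub>R DA v u"
    using has_derivative_unique[OF A] by metis
qed

text \<open>Differentiability is known only for fixed vector arguments. Expanding \<open>X y\<close>
  in \<open>Basis\<close> turns the expression into a finite sum of ordinary products.\<close>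

lemma has_derivative_linear_family:
  fixes A :: "'e::real_normed_vector \<Rightarrow> 'f::euclidean_space \<Rightarrow> 'b::real_normed_vector"
  assumes S: "open S" "x \<in> S" and lin: "\<And>y. y \<in> S \<Longrightarrow> linear (A y)"
    and A: "\<And>v. ((\<lambda>y. A y v) has_derivative DA v) (at x)"
    and X: "(X has_derivative DX) (at x)"
  shows "((\<lambda>y. A y (X y)) has_derivative (\<lambda>u. DA (X x) u + A x (DX u))) (at x)"
proof -
  have expand: "(\<Sum>b\<in>Basis. (v \<bullet> b) *\<^sub>R f b) = f v" if "linear f" for v and f :: "'f \<Rightarrow> 'b"
    using euclidean_representation[of v] that
    by (metis (no_types, lifting) linear_cmul linear_sum sum.cong)
  have "((\<lambda>y. \<Sum>b\<in>Basis. (X y \<bullet> b) *\<^sub>R A y b) has_derivative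
      (\<lambda>u. \<Sum>b\<in>Basis. (X x \<bullet> b) *\<^sub>R DA b u + (DX u \<bullet> b) *\<^sub>R A x b)) (at x)"
    by (intro has_derivative_sum has_derivative_scaleR A has_derivative_inner_left X)
  from has_derivative_transform_within_open[OF this S expand[OF lin]]
  show ?thesis
    by (simp add: sum.distrib expand[OF lin[OF S(2)]]
        expand[OF linear_derivative_linear_family[OF S lin A]])
qed

section \<open>Orthonormal bases and traces for an inner product\<close>

text \<open>\<open>G\<close> stands for the value of a metric at one point; it is unrelated to the
  inner product of the coordinate space.\<close>

locale inner_form =
  fixes G :: "'e::euclidean_space \<Rightarrow> 'e \<Rightarrow> real"
  assumes lin: "linear (G u)" and sym: "G u v = G v u" and pos: "u \<noteq> 0 \<Longrightarrow> G u u > 0"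
begin

lemma lin_left: "linear (\<lambda>u. G u v)"
  using lin[of v] ext[of "\<lambda>u. G u v" "G v", OF sym] by simp

lemma G_simps [simp]:
  "G u (v + w) = G u v + G u w" "G (v + w) u = G v u + G w u"
  "G u (v - w) = G u v - G u w" "G (v - w) u = G v u - G w u"
  "G u (- v) = - G u v" "G (- v) u = - G v u"
  "G u (r *\<^sub>R v) = r * G u v" "G (r *\<^sub>R v) u = r * G v u"
  "G u 0 = 0" "G 0 u = 0"
  using linear_add[OF lin] linear_diff[OF lin] linear_neg[OF lin] linear_cmul[OF lin] linear_0[OF lin]
    linear_add[OF lin_left] linear_diff[OF lin_left] linear_neg[OF lin_left]
    linear_cmul[OF lin_left] linear_0[OF lin_left]
  by simp_all

lemma G_sum: "G (sum f I) u = (\<Sum>i\<in>I. G (f i) u)" "G u (sum f I) = (\<Sum>i\<in>I. G u (f i))"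
  using linear_sum[OF lin_left] linear_sum[OF lin] by auto

lemma eqI: "u = v" if "\<And>z. G u z = G v z"
  using that[of "u - v"] pos[of "u - v"] by fastforce

lemma orthonormal_sum:
  assumes "finite E" "\<forall>e\<in>E. \<forall>f\<in>E. G e f = (if e = f then 1 else 0)" "f \<in> E"
  shows "G (\<Sum>e\<in>E. r e *\<^sub>R e) f = r f"
proof -
  have "G (\<Sum>e\<in>E. r e *\<^sub>R e) f = (\<Sum>e\<in>E. if e = f then r e else 0)"
    unfolding G_sum using assms by (intro sum.cong) auto
  then show ?thesis using assms by simp
qed

lemma orthonormal_independent:
  assumes "finite E" "\<forall>e\<in>E. \<forall>f\<in>E. G e f = (if e = f then 1 else 0)"
  shows "independent E"
  unfolding independent_explicit_module
proof (intro allI impI)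
  fix t u v
  assume t: "finite t" "t \<subseteq> E" "(\<Sum>v\<in>t. u v *\<^sub>R v) = 0" "v \<in> t"
  then have "G (\<Sum>v\<in>t. u v *\<^sub>R v) v = u v"
    by (intro orthonormal_sum) (use assms(2) t(1,2,4) in blast)+
  then show "u v = 0" using t by simp
qed

text \<open>Orthonormal sets are independent, hence of bounded size, and one of largest size must
  span. So the choice in \<open>codiff\<close> yields a genuine basis.\<close>

lemma orthonormal_basis_exists: "\<exists>E. orthonormal_basis G E"
proof -
  define P where "P E \<longleftrightarrow> finite E \<and> (\<forall>e\<in>E. \<forall>f\<in>E. G e f = (if e = f then 1 else 0))" for E
  have "P {}" by (simp add: P_def)
  moreover have "card E < Suc DIM('e)" if "P E" for E
    using that orthonormal_independent[of E] independent_bound[of E] by (auto simp: P_def)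
  ultimately obtain E where E: "P E" and max: "\<And>E'. P E' \<Longrightarrow> card E' \<le> card E"
    using ex_has_greatest_nat[of P "{}" card "Suc DIM('e)"] by (auto simp: less_imp_le)
  have "span E = UNIV"
  proof (rule ccontr)
    assume "span E \<noteq> UNIV"
    then obtain v where v: "v \<notin> span E" by blast
    \<comment> \<open>Gram-Schmidt: \<open>w\<close> is \<open>v\<close> minus its
      \<open>G\<close>-orthogonal projection to \<open>span E\<close>; normalised, it would enlarge
      \<open>E\<close>.\<close>
    define w where "w = v - (\<Sum>e\<in>E. G v e *\<^sub>R e)"
    have w_span: "w \<notin> span E"
    proof
      assume "w \<in> span E"
      then have "w + (\<Sum>e\<in>E. G v e *\<^sub>R e) \<in> span E"
        by (intro span_add span_sum span_scale) (auto intro: span_base)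
      then show False using v by (simp add: w_def)
    qed
    have orth: "G w f = 0" if "f \<in> E" for f
      using orthonormal_sum[of E f "G v"] E that by (simp add: w_def P_def)
    define n where "n = (1 / sqrt (G w w)) *\<^sub>R w"
    have "w \<noteq> 0" using w_span span_zero by metis
    then have "G w w > 0" by (rule pos)
    then have "G n n = 1" by (simp add: n_def real_div_sqrt)
    moreover have "G n f = 0" "G f n = 0" if "f \<in> E" for f
      using orth[OF that] sym by (simp_all add: n_def)
    moreover have "n \<notin> E"
      using calculation E by force
    ultimately have "P (insert n E)" using E by (auto simp: P_def)
    from max[OF this] \<open>n \<notin> E\<close> E show False by (simp add: P_def)
  qed
  then show ?thesis using E by (auto simp: orthonormal_basis_def P_def)
qed

lemma orthonormal_expand:
  assumes "orthonormal_basis G E"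
  shows "(\<Sum>e\<in>E. G v e *\<^sub>R e) = v"
proof (rule eqI)
  fix z
  have "G (\<Sum>e\<in>E. G v e *\<^sub>R e) z = G v z" if "z \<in> E" for z
    using orthonormal_sum[of E z] assms that by (auto simp: orthonormal_basis_def)
  moreover have "z \<in> span E" using assms by (simp add: orthonormal_basis_def)
  ultimately show "G (\<Sum>e\<in>E. G v e *\<^sub>R e) z = G v z"
    using linear_eq_on_span[OF lin lin] by blast
qed

lemma orthonormal_expand_apply:
  fixes f :: "'e \<Rightarrow> real"
  assumes "orthonormal_basis G E" "linear f"
  shows "(\<Sum>e\<in>E. G v e * f e) = f v"
proof -
  have "f v = f (\<Sum>e\<in>E. G v e *\<^sub>R e)" using orthonormal_expand[OF assms(1)] by simp
  also have "\<dots> = (\<Sum>e\<in>E. G v e * f e)" using assms(2) by (simp add: linear_sum linear_cmul)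
  finally show ?thesis by simp
qed

text \<open>The values \<open>f e\<close> are the coefficients of the representing vector. This
  gives meaning to the \<open>THE\<close> in \<open>christoffel\<close>.\<close>

lemma riesz:
  assumes "linear f"
  shows "\<exists>!w. \<forall>z. G w z = f z"
proof -
  obtain E where E: "orthonormal_basis G E" using orthonormal_basis_exists by blast
  have "G (\<Sum>e\<in>E. f e *\<^sub>R e) z = f z" for z
    using orthonormal_expand_apply[OF E assms, of z] by (simp add: G_sum sym[of z] mult.commute)
  then show ?thesis by (metis eqI)
qed

text \<open>Expanding \<open>F e\<close> in the basis and swapping the two sums moves
  \<open>F\<close> to the other argument; skewness supplies the sign.\<close>

lemma trace_skew:
  assumes E: "orthonormal_basis G E" and skew: "\<And>u v. G (F u) v = - G u (F v)"
    and b: "\<And>u. linear (b u)" "\<And>v. linear (\<lambda>u. b u v :: real)"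
  shows "(\<Sum>e\<in>E. b (F e) e) = - (\<Sum>e\<in>E. b e (F e))"
proof -
  have "(\<Sum>e\<in>E. b (F e) e) = (\<Sum>e\<in>E. \<Sum>f\<in>E. G (F e) f * b f e)"
    by (simp add: orthonormal_expand_apply[OF E b(2)])
  also have "\<dots> = (\<Sum>f\<in>E. \<Sum>e\<in>E. G (F e) f * b f e)" by (rule sum.swap)
  also have "\<dots> = (\<Sum>f\<in>E. \<Sum>e\<in>E. - (G (F f) e * b f e))"
    using skew sym by (intro sum.cong refl) (metis mult_minus_left)
  also have "\<dots> = - (\<Sum>f\<in>E. b f (F f))"
    by (simp add: sum_negf orthonormal_expand_apply[OF E b(1)])
  finally show ?thesis .
qed

text \<open>
  Here \<open>B u\<close> plays the role of \<open>\<nabla>\<^sub>u \<phi>\<close> and \<open>N\<close> that of \<open>\<nabla>\<xi>\<close>.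
\<close>

lemma trace_eq_0:
  assumes E: "orthonormal_basis G E"
    and F: "\<And>u v. G (F u) v = - G u (F v)" "\<And>v. F (F v) = - v + G \<xi> v *\<^sub>R \<xi>" "F \<xi> = 0"
    and unit: "G \<xi> \<xi> = 1"
    and B: "\<And>u. linear (B u)" "\<And>v. linear (\<lambda>u. B u v)"
    and N: "linear N" "\<And>u v. G (N u) v = G u (N v)" "\<And>u. G (N u) \<xi> = 0"
    and BF: "\<And>u v. B u (F v) + F (B u v) = G (N u) v *\<^sub>R \<xi> + G \<xi> v *\<^sub>R N u"
    and B\<xi>: "\<And>u. B u \<xi> = - F (N u)"
    and skew: "\<And>u v w. G (B u v) w = - G v (B u w)"
    and cyclic: "\<And>u v w. G v (B u w) + G w (B v u) + G u (B w v) = 0"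
  shows "(\<Sum>e\<in>E. G e (B e v)) = 0"
proof -
  have linGB: "linear (\<lambda>u. G w (B u v))" "linear (\<lambda>v. G w (B u v))" for u v w
    using linear_add[OF B(1)] linear_add[OF B(2)] linear_cmul[OF B(1)] linear_cmul[OF B(2)]
    by (auto intro!: linearI)
  have FB: "F (B u v) = G (N u) v *\<^sub>R \<xi> + G \<xi> v *\<^sub>R N u - B u (F v)" for u v
    using BF[of u v] by (simp add: algebra_simps)
  \<comment> \<open>\<open>B u\<close> after \<open>F\<close> and \<open>F\<close> after
    \<open>B u\<close> have the same trace, and by \<open>BF\<close> these traces add up to
    \<open>2 * G (N u) \<xi> = 0\<close>.\<close>
  have t1: "(\<Sum>e\<in>E. G e (B u (F e))) = 0" for u
  proof -
    have "(\<Sum>e\<in>E. G (F e) (B u e)) = - (\<Sum>e\<in>E. G e (B u (F e)))"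
      by (rule trace_skew[OF E F(1)]) (use linGB lin_left in auto)
    moreover have "(\<Sum>e\<in>E. G (F e) (B u e)) =
        - ((\<Sum>e\<in>E. G (N u) e * G \<xi> e) + (\<Sum>e\<in>E. G \<xi> e * G (N u) e) - (\<Sum>e\<in>E. G e (B u (F e))))"
      by (simp add: F(1) FB sum_negf[symmetric] sum.distrib[symmetric] sum_subtractf[symmetric] sym
          del: sum_negf)
    ultimately have "2 * (\<Sum>e\<in>E. G e (B u (F e))) = 2 * (\<Sum>e\<in>E. G (N u) e * G \<xi> e)"
      by (simp add: mult.commute)
    also have "(\<Sum>e\<in>E. G (N u) e * G \<xi> e) = 0"
      using orthonormal_expand_apply[OF E lin, of "N u" \<xi>] N(3) by (simp add: sym)
    finally show ?thesis by simp
  qed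
  \<comment> \<open>Put \<open>e\<close> and \<open>F e\<close> into \<open>cyclic\<close> and sum:
    one term vanishes by \<open>t1\<close>, the other two are equal by \<open>trace_skew\<close> and
    \<open>skew\<close>.\<close>
  have t2: "(\<Sum>e\<in>E. G (F e) (B e v)) = 0" for v
  proof -
    have "(\<Sum>e\<in>E. G v (B (F e) e)) = - (\<Sum>e\<in>E. G v (B e (F e)))"
      by (rule trace_skew[OF E F(1)]) (use linGB in auto)
    also have "\<dots> = (\<Sum>e\<in>E. G (F e) (B e v))"
      by (simp only: sym[of "F _"] skew sum_negf)
    finally have "(\<Sum>e\<in>E. G v (B (F e) e)) = (\<Sum>e\<in>E. G (F e) (B e v))" .
    moreover have "(\<Sum>e\<in>E. G e (B v (F e)) + G (F e) (B e v) + G v (B (F e) e)) = 0"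
      by (simp add: cyclic)
    ultimately show ?thesis by (simp add: sum.distrib t1)
  qed
  \<comment> \<open>By skewness of \<open>F\<close>, \<open>t2\<close> says that the trace of
    \<open>F (B e v)\<close> against \<open>e\<close> is zero; \<open>FB\<close> expands it into the
    two sides.\<close>
  have t3: "(\<Sum>e\<in>E. G e (B e (F v))) = G \<xi> v * (\<Sum>e\<in>E. G e (N e))" for v
  proof -
    have "0 = (\<Sum>e\<in>E. G e (F (B e v)))"
      using t2[of v] by (simp add: F(1) sum_negf)
    also have "\<dots> = (\<Sum>e\<in>E. G \<xi> e * G e (N v)) + G \<xi> v * (\<Sum>e\<in>E. G e (N e))
        - (\<Sum>e\<in>E. G e (B e (F v)))"
      by (simp add: FB N(2) sum.distrib sum_subtractf sum_distrib_left sym[of \<xi>] mult.commute)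
    also have "(\<Sum>e\<in>E. G \<xi> e * G e (N v)) = G \<xi> (N v)"
      by (rule orthonormal_expand_apply[OF E lin_left])
    also have "\<dots> = 0" using N(3) sym by metis
    finally show ?thesis by simp
  qed
  have div: "(\<Sum>e\<in>E. G e (N e)) = 0"
    using t3[of \<xi>] B(1) by (simp add: F(3) unit linear_0)
  \<comment> \<open>The sum equals its own negative, because \<open>F\<close> is skew and
    \<open>N\<close> symmetric.\<close>
  have "(\<Sum>e\<in>E. G (F e) (N e)) = - (\<Sum>e\<in>E. G e (N (F e)))"
    by (rule trace_skew[OF E F(1)])
      (use N(1) lin_left in \<open>auto intro!: linearI simp: linear_add linear_cmul\<close>)
  also have "\<dots> = - (\<Sum>e\<in>E. G (F e) (N e))" by (metis N(2) sym)
  finally have "(\<Sum>e\<in>E. G e (B e \<xi>)) = 0"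
    by (simp add: B\<xi> F(1)[symmetric] sum_negf)
  \<comment> \<open>Split \<open>v\<close> into a multiple of \<open>\<xi>\<close> and a vector in
    the image of \<open>F\<close>; the latter is covered by \<open>t3\<close> and
    \<open>div\<close>.\<close>
  moreover have "v = G \<xi> v *\<^sub>R \<xi> - F (F v)" by (simp add: F(2))
  then have "B e v = G \<xi> v *\<^sub>R B e \<xi> - B e (F (F v))" for e
    using B(1)[of e] by (metis linear_diff linear_cmul)
  then have "(\<Sum>e\<in>E. G e (B e v)) = G \<xi> v * (\<Sum>e\<in>E. G e (B e \<xi>)) - (\<Sum>e\<in>E. G e (B e (F (F v))))"
    by (simp add: sum_subtractf sum_distrib_left)
  ultimately show ?thesis by (simp add: t3 div)
qed

end

section \<open>Almost cosymplectic structures in a single chart\<close>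

text \<open>The Laplacian is computed chart by chart. First-order differentiability suffices because
  \<open>d\<Phi>\<close> and \<open>\<delta>\<Phi>\<close> are known to vanish on all of
  \<open>S\<close> before they are differentiated.\<close>

locale almost_cosymplectic_rep =
  fixes S :: "'e::euclidean_space set" and g :: "'e \<Rightarrow> 'e \<Rightarrow> 'e \<Rightarrow> real"
    and \<phi> :: "'e \<Rightarrow> 'e \<Rightarrow> 'e" and \<xi> :: "'e \<Rightarrow> 'e" and \<eta> :: "'e \<Rightarrow> 'e \<Rightarrow> real"
  assumes open_S: "open S"
    and inner: "y \<in> S \<Longrightarrow> inner_form (g y)"
    and lin_\<phi>: "y \<in> S \<Longrightarrow> linear (\<phi> y)"
    and lin_\<eta>: "y \<in> S \<Longrightarrow> linear (\<eta> y)"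
    and diff_g: "y \<in> S \<Longrightarrow> (\<lambda>y. g y u v) differentiable at y"
    and diff_\<phi>: "y \<in> S \<Longrightarrow> (\<lambda>y. \<phi> y u) differentiable at y"
    and diff_\<xi>: "y \<in> S \<Longrightarrow> \<xi> differentiable at y"
    and diff_\<eta>: "y \<in> S \<Longrightarrow> (\<lambda>y. \<eta> y u) differentiable at y"
    and \<eta>_\<xi>: "y \<in> S \<Longrightarrow> \<eta> y (\<xi> y) = 1"
    and \<phi>_\<phi>: "y \<in> S \<Longrightarrow> \<phi> y (\<phi> y u) = - u + \<eta> y u *\<^sub>R \<xi> y"
    and g_\<phi>_\<phi>: "y \<in> S \<Longrightarrow> g y (\<phi> y u) (\<phi> y v) = g y u v - \<eta> y u * \<eta> y v"
    and closed_\<Phi>: "y \<in> S \<Longrightarrow> length vs = 3 \<Longrightarrow>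
          ext_deriv (\<lambda>y vs. g y (vs ! 0) (\<phi> y (vs ! 1))) y vs = 0"
    and closed_\<eta>: "y \<in> S \<Longrightarrow> length vs = 2 \<Longrightarrow> ext_deriv (\<lambda>y vs. \<eta> y (vs ! 0)) y vs = 0"
begin

text \<open>From \<open>\<phi>\<^sup>2 \<xi> = 0\<close> the formula for
  \<open>\<phi>\<^sup>2\<close> makes \<open>\<phi> \<xi>\<close> a multiple of
  \<open>\<xi>\<close>. Another application of \<open>\<phi>\<close> forces the factor or
  \<open>\<phi> \<xi>\<close> itself to be zero.\<close>

lemma \<phi>_\<xi>: "\<phi> y (\<xi> y) = 0" if "y \<in> S"
proof -
  note lin = lin_\<phi>[OF that]
  have sq: "\<phi> y (\<phi> y (\<xi> y)) = 0" by (simp add: \<phi>_\<phi> \<eta>_\<xi> that)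
  then have "\<phi> y (\<xi> y) = \<eta> y (\<phi> y (\<xi> y)) *\<^sub>R \<xi> y"
    using \<phi>_\<phi>[OF that, of "\<phi> y (\<xi> y)"] lin by (simp add: linear_0)
  then have "0 = \<eta> y (\<phi> y (\<xi> y)) *\<^sub>R \<phi> y (\<xi> y)"
    using sq lin by (metis linear_cmul)
  then show ?thesis using \<open>\<phi> y (\<xi> y) = \<eta> y (\<phi> y (\<xi> y)) *\<^sub>R \<xi> y\<close> by fastforce
qed

text \<open>Evaluate the cube of \<open>\<phi>\<close> in its two bracketings and use that
  \<open>\<xi>\<close> is nonzero.\<close>

lemma \<eta>_\<phi>: "\<eta> y (\<phi> y u) = 0" if "y \<in> S"
proof -
  have "\<phi> y (\<phi> y (\<phi> y u)) = - \<phi> y u"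
    using \<phi>_\<xi>[OF that] lin_\<phi>[OF that]
    by (simp add: \<phi>_\<phi>[OF that, of u] linear_add linear_neg linear_cmul linear_diff)
  then have "\<eta> y (\<phi> y u) *\<^sub>R \<xi> y = 0" using \<phi>_\<phi>[OF that, of "\<phi> y u"] by simp
  then show ?thesis using \<eta>_\<xi>[OF that] lin_\<eta>[OF that] by (auto simp: linear_0)
qed

text \<open>Compute \<open>g (\<phi> u) (\<phi> (\<phi> v))\<close> once by compatibility of the
  metric and once by the formula for the square of \<open>\<phi>\<close>.\<close>

lemma \<phi>_skew: "g y (\<phi> y u) v = - g y u (\<phi> y v)" if "y \<in> S"
proof -
  interpret inner_form "g y" by (rule inner[OF that])
  have "g y (\<phi> y u) (\<phi> y (\<phi> y v)) = g y u (\<phi> y v)" by (simp add: g_\<phi>_\<phi> \<eta>_\<phi> that)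
  moreover have "g y (\<phi> y u) (\<xi> y) = 0"
    using g_\<phi>_\<phi>[OF that, of "\<phi> y u" "\<xi> y"] by (simp add: \<phi>_\<xi> \<eta>_\<phi> that)
  ultimately show ?thesis by (simp add: \<phi>_\<phi> that del: g_\<phi>_\<phi>)
qed

lemma \<eta>_eq: "\<eta> y u = g y (\<xi> y) u" if "y \<in> S"
proof -
  interpret inner_form "g y" by (rule inner[OF that])
  show ?thesis using g_\<phi>_\<phi>[OF that, of "\<xi> y" u] by (simp add: \<phi>_\<xi> \<eta>_\<xi> that)
qed

context
  fixes x assumes x: "x \<in> S"
begin

interpretation inner_form "g x" by (rule inner[OF x])

abbreviation (input) "Dg u v w \<equiv> dderiv (\<lambda>y. g y v w) x u"
abbreviation (input) "D\<phi> u v \<equiv> dderiv (\<lambda>y. \<phi> y v) x u"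
abbreviation (input) "D\<eta> u v \<equiv> dderiv (\<lambda>y. \<eta> y v) x u"
abbreviation (input) "D\<xi> u \<equiv> dderiv \<xi> x u"
abbreviation (input) "\<Gamma> \<equiv> christoffel g x"
text \<open>For constant \<open>u\<close> and \<open>v\<close> these are the covariant derivatives
  \<open>(\<nabla>\<^sub>u \<phi>) v\<close> and \<open>\<nabla>\<^sub>u \<xi>\<close> in
  coordinates.\<close>

abbreviation (input) "B u v \<equiv> D\<phi> u v + \<Gamma> u (\<phi> x v) - \<phi> x (\<Gamma> u v)"
abbreviation (input) "N u \<equiv> D\<xi> u + \<Gamma> u (\<xi> x)"

lemmas derivs = diff_g[OF x, THEN has_derivative_dderiv] diff_\<phi>[OF x, THEN has_derivative_dderiv]
  diff_\<xi>[OF x, THEN has_derivative_dderiv] diff_\<eta>[OF x, THEN has_derivative_dderiv]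

lemmas lin_\<phi>_simps = linear_add[OF lin_\<phi>[OF x]] linear_diff[OF lin_\<phi>[OF x]]
  linear_neg[OF lin_\<phi>[OF x]] linear_cmul[OF lin_\<phi>[OF x]] linear_0[OF lin_\<phi>[OF x]]

lemma linear_Dg: "linear (\<lambda>u. Dg u v w)" "linear (\<lambda>v. Dg u v w)" "linear (\<lambda>w. Dg u v w)"
  using has_derivative_linear[OF derivs(1)]
    linear_derivative_linear_family[OF open_S x inner_form.lin_left[OF inner] derivs(1)]
    linear_derivative_linear_family[OF open_S x inner_form.lin[OF inner] derivs(1)]
  by auto

lemma Dg_sym: "Dg u v w = Dg u w v"
proof -
  have "((\<lambda>y. g y w v) has_derivative dderiv (\<lambda>y. g y v w) x) (at x)"
    by (rule has_derivative_transform_within_open[OF derivs(1) open_S x])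
       (rule inner_form.sym[OF inner])
  from dderiv_eq[OF this] show ?thesis by simp
qed

lemma linear_D\<phi>: "linear (\<lambda>u. D\<phi> u v)" "linear (\<lambda>v. D\<phi> u v)"
  using has_derivative_linear[OF derivs(2)]
    linear_derivative_linear_family[OF open_S x lin_\<phi> derivs(2)] by auto

lemma christoffel_eq: "2 * g x (\<Gamma> u v) z = Dg u v z + Dg v u z - Dg z u v"
proof -
  let ?f = "\<lambda>z. (Dg u v z + Dg v u z - Dg z u v) / 2"
  have "linear ?f"
    by (auto intro!: linearI simp: linear_Dg[THEN linear_add] linear_Dg[THEN linear_cmul] field_simps)
  from riesz[OF this]
  have "\<exists>!w. \<forall>z. 2 * g x w z = Dg u v z + Dg v u z - Dg z u v"
    by (simp add: field_simps)
  from theI'[OF this] show ?thesis unfolding christoffel_def by blast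
qed

lemma christoffel_sym: "\<Gamma> u v = \<Gamma> v u"
proof (rule eqI)
  fix z show "g x (\<Gamma> u v) z = g x (\<Gamma> v u) z"
    using christoffel_eq[of u v z] christoffel_eq[of v u z] Dg_sym[of u v z] by simp
qed

text \<open>In the sum of the Koszul formulas for \<open>\<Gamma> u v\<close> against
  \<open>w\<close> and \<open>\<Gamma> u w\<close> against \<open>v\<close>, all terms except the
  derivative along \<open>u\<close> cancel.\<close>

lemma metric_compat: "Dg u v w = g x (\<Gamma> u v) w + g x v (\<Gamma> u w)"
  using christoffel_eq[of u v w] christoffel_eq[of u w v] Dg_sym[of v w u] Dg_sym[of u w v]
    Dg_sym[of u v w] sym[of v "\<Gamma> u w"] by simp

lemma linear_christoffel: "linear (\<lambda>v. \<Gamma> u v)" "linear (\<lambda>v. \<Gamma> v u)"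
proof -
  show "linear (\<lambda>v. \<Gamma> u v)"
  proof (rule linearI)
    fix v w r
    show "\<Gamma> u (v + w) = \<Gamma> u v + \<Gamma> u w"
    proof (rule eqI)
      fix z show "g x (\<Gamma> u (v + w)) z = g x (\<Gamma> u v + \<Gamma> u w) z"
        using christoffel_eq[of u "v + w" z] christoffel_eq[of u v z] christoffel_eq[of u w z]
        by (simp add: linear_Dg[THEN linear_add])
    qed
    show "\<Gamma> u (r *\<^sub>R v) = r *\<^sub>R \<Gamma> u v"
    proof (rule eqI)
      fix z
      have "2 * g x (\<Gamma> u (r *\<^sub>R v)) z = r * (2 * g x (\<Gamma> u v) z)"
        unfolding christoffel_eq by (simp add: linear_Dg[THEN linear_cmul] algebra_simps)
      then show "g x (\<Gamma> u (r *\<^sub>R v)) z = g x (r *\<^sub>R \<Gamma> u v) z" by simp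
    qed
  qed
  then show "linear (\<lambda>v. \<Gamma> v u)" by (simp add: christoffel_sym[of _ u])
qed

lemma linear_B: "linear (\<lambda>u. B u v)" "linear (\<lambda>v. B u v)"
  by (auto intro!: linearI simp: lin_\<phi>_simps linear_christoffel[THEN linear_add]
      linear_christoffel[THEN linear_cmul] linear_D\<phi>[THEN linear_add] linear_D\<phi>[THEN linear_cmul]
      algebra_simps)

lemma linear_N: "linear (\<lambda>u. N u)"
  using has_derivative_linear[OF derivs(3)]
  by (auto intro!: linearI simp: linear_christoffel[THEN linear_add]
      linear_christoffel[THEN linear_cmul] linear_add linear_cmul algebra_simps)

lemma D\<Phi>: "((\<lambda>y. g y v (\<phi> y w)) has_derivative
    (\<lambda>u. Dg u v (\<phi> x w) + g x v (D\<phi> u w))) (at x)"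
  by (rule has_derivative_linear_family[OF open_S x _ derivs(1) derivs(2)])
     (rule inner_form.lin[OF inner])

text \<open>Separates the tensorial part from the Christoffel terms, which are exactly those
  subtracted in \<open>cov_deriv\<close>.\<close>

lemma dderiv_\<Phi>: "dderiv (\<lambda>y. g y v (\<phi> y w)) x u =
    g x v (B u w) + g x (\<Gamma> u v) (\<phi> x w) + g x v (\<phi> x (\<Gamma> u w))"
  by (simp add: dderiv_eq[OF D\<Phi>] metric_compat)

lemma cov_deriv_\<Phi>: "cov_deriv g (\<lambda>y vs. g y (vs ! 0) (\<phi> y (vs ! 1))) x u [v, w] = g x v (B u w)"
  by (simp add: cov_deriv_def dderiv_\<Phi> numeral_2_eq_2)

text \<open>Differentiate the antisymmetry of \<Phi>; the Christoffel terms cancel since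
  \<open>\<phi>\<close> is skew.\<close>

lemma B_skew: "g x (B u v) w = - g x v (B u w)"
proof -
  have "((\<lambda>y. g y w (\<phi> y v)) has_derivative
      (\<lambda>u. - (Dg u v (\<phi> x w) + g x v (D\<phi> u w)))) (at x)"
    by (rule has_derivative_transform_within_open[OF has_derivative_minus[OF D\<Phi>] open_S x])
       (metis \<phi>_skew inner inner_form.sym)
  from dderiv_eq[OF this] have "dderiv (\<lambda>y. g y w (\<phi> y v)) x u = - dderiv (\<lambda>y. g y v (\<phi> y w)) x u"
    by (simp add: dderiv_eq[OF D\<Phi>])
  then have "g x w (B u v) + g x (\<Gamma> u w) (\<phi> x v) + g x w (\<phi> x (\<Gamma> u v)) =
      - (g x v (B u w) + g x (\<Gamma> u v) (\<phi> x w) + g x v (\<phi> x (\<Gamma> u w)))"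
    unfolding dderiv_\<Phi> .
  moreover have "g x a (\<phi> x b) = - g x b (\<phi> x a)" for a b
    using \<phi>_skew[OF x, of b a] sym[of a "\<phi> x b"] by simp
  then have "g x (\<Gamma> u w) (\<phi> x v) = - g x v (\<phi> x (\<Gamma> u w))"
    "g x (\<Gamma> u v) (\<phi> x w) = - g x w (\<phi> x (\<Gamma> u v))" by blast+
  ultimately have "g x w (B u v) = - g x v (B u w)" by linarith
  then show ?thesis by (simp only: sym[of _ w])
qed

text \<open>This is \<open>d\<Phi> = 0\<close> written with a torsion-free connection: symmetry of
  \<open>\<Gamma>\<close> removes the Christoffel terms.\<close>

lemma B_cyclic: "g x v (B u w) + g x w (B v u) + g x u (B w v) = 0"
proof -
  have d: "dderiv (\<lambda>y. g y v (\<phi> y w)) x u - dderiv (\<lambda>y. g y u (\<phi> y w)) x v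
      + dderiv (\<lambda>y. g y u (\<phi> y v)) x w = 0"
    using closed_\<Phi>[OF x, of "[u, v, w]"] by (simp add: ext_deriv_def numeral_3_eq_3 numeral_2_eq_2)
  have sk: "g x a (\<phi> x b) = - g x b (\<phi> x a)" for a b
    using \<phi>_skew[OF x, of b a] sym[of a "\<phi> x b"] by simp
  \<comment> \<open>\<open>b u v w\<close> is \<open>(\<nabla>\<^sub>u \<Phi>)(v, w)\<close> and
    \<open>c u v w\<close> is \<open>\<Phi>(\<Gamma> u v, w)\<close>; as atoms they leave a problem
    of linear arithmetic.\<close>
  define b where "b u v w = g x v (B u w)" for u v w
  define c where "c u v w = g x (\<Gamma> u v) (\<phi> x w)" for u v w
  have c': "g x w (\<phi> x (\<Gamma> u v)) = - c u v w" for u v w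
    unfolding c_def by (rule sk)
  have csym: "c u v w = c v u w" for u v w
    by (simp only: c_def christoffel_sym[of u v])
  have bsk: "b v u w = - b v w u"
    by (simp only: b_def sym[of w] B_skew minus_minus)
  have "b u v w + b v w u + b w u v = 0"
    using d bsk csym[of v u w] csym[of w u v] csym[of w v u]
    unfolding dderiv_\<Phi> b_def[symmetric] c_def[symmetric] c' by linarith
  then show ?thesis unfolding b_def .
qed

lemma D\<eta>_eq: "D\<eta> u v = g x (N u) v + g x (\<xi> x) (\<Gamma> u v)"
proof -
  have "((\<lambda>y. g y (\<xi> y) v) has_derivative (\<lambda>u. Dg u (\<xi> x) v + g x (D\<xi> u) v)) (at x)"
    by (rule has_derivative_linear_family[OF open_S x _ derivs(1) derivs(3)])
       (rule inner_form.lin_left[OF inner])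
  then have "((\<lambda>y. \<eta> y v) has_derivative (\<lambda>u. Dg u (\<xi> x) v + g x (D\<xi> u) v)) (at x)"
    by (rule has_derivative_transform_within_open[OF _ open_S x]) (simp add: \<eta>_eq)
  from dderiv_eq[OF this] show ?thesis by (simp add: metric_compat)
qed

text \<open>Antisymmetrising the previous formula gives \<open>d\<eta> = 0\<close> on the left, and
  the symmetric Christoffel term drops out.\<close>

lemma N_sym: "g x (N u) v = g x u (N v)"
proof -
  have "D\<eta> u v - D\<eta> v u = 0"
    using closed_\<eta>[OF x, of "[u, v]"] by (simp add: ext_deriv_def numeral_2_eq_2)
  then have "g x (N u) v = g x (N v) u"
    using D\<eta>_eq[of u v] D\<eta>_eq[of v u] christoffel_sym[of u v] by simp
  then show ?thesis by (simp only: sym[of u])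
qed

text \<open>Differentiate the constant function \<open>\<eta> y (\<xi> y) = 1\<close>: \<xi> has
  unit length, so its derivative is orthogonal to it.\<close>

lemma N_\<xi>: "g x (N u) (\<xi> x) = 0"
proof -
  have D: "((\<lambda>y. \<eta> y (\<xi> y)) has_derivative (\<lambda>u. D\<eta> u (\<xi> x) + \<eta> x (D\<xi> u))) (at x)"
    by (rule has_derivative_linear_family[OF open_S x lin_\<eta> derivs(4) derivs(3)])
  have D': "((\<lambda>y. \<eta> y (\<xi> y)) has_derivative (\<lambda>u. 0)) (at x)"
    by (rule has_derivative_transform_within_open[OF has_derivative_const[of 1] open_S x])
       (simp add: \<eta>_\<xi>)
  have "D\<eta> u (\<xi> x) + \<eta> x (D\<xi> u) = 0" by (rule fun_cong[OF has_derivative_unique[OF D D']])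
  then have "g x (N u) (\<xi> x) + g x (\<xi> x) (N u) = 0"
    by (simp add: D\<eta>_eq \<eta>_eq[OF x])
  then show ?thesis by (simp only: sym[of "\<xi> x"])
qed

text \<open>Differentiate \<open>\<phi> y (\<xi> y) = 0\<close>.\<close>

lemma B_\<xi>: "B u (\<xi> x) = - \<phi> x (N u)"
proof -
  have D: "((\<lambda>y. \<phi> y (\<xi> y)) has_derivative (\<lambda>u. D\<phi> u (\<xi> x) + \<phi> x (D\<xi> u))) (at x)"
    by (rule has_derivative_linear_family[OF open_S x lin_\<phi> derivs(2) derivs(3)])
  have D': "((\<lambda>y. \<phi> y (\<xi> y)) has_derivative (\<lambda>u. 0)) (at x)"
    by (rule has_derivative_transform_within_open[OF has_derivative_const[of 0] open_S x])
       (simp add: \<phi>_\<xi>)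
  have "D\<phi> u (\<xi> x) + \<phi> x (D\<xi> u) = 0" by (rule fun_cong[OF has_derivative_unique[OF D D']])
  then show ?thesis
    by (simp add: \<phi>_\<xi>[OF x] linear_christoffel(1)[THEN linear_0] lin_\<phi>_simps algebra_simps
        eq_neg_iff_add_eq_0)
qed

text \<open>This is the covariant derivative of
  \<open>\<phi>\<^sup>2 = - I + \<eta> \<otimes> \<xi>\<close>: both sides are differentiated and
  the Christoffel terms regrouped.\<close>

lemma B_\<phi>: "B u (\<phi> x v) + \<phi> x (B u v) = g x (N u) v *\<^sub>R \<xi> x + g x (\<xi> x) v *\<^sub>R N u"
proof -
  have D: "((\<lambda>y. \<phi> y (\<phi> y v)) has_derivative (\<lambda>u. D\<phi> u (\<phi> x v) + \<phi> x (D\<phi> u v))) (at x)"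
    by (rule has_derivative_linear_family[OF open_S x lin_\<phi> derivs(2) derivs(2)])
  have "((\<lambda>y. - v + \<eta> y v *\<^sub>R \<xi> y) has_derivative
      (\<lambda>u. 0 + (\<eta> x v *\<^sub>R D\<xi> u + D\<eta> u v *\<^sub>R \<xi> x))) (at x)"
    by (intro has_derivative_add has_derivative_const has_derivative_scaleR derivs)
  then have D': "((\<lambda>y. \<phi> y (\<phi> y v)) has_derivative
      (\<lambda>u. 0 + (\<eta> x v *\<^sub>R D\<xi> u + D\<eta> u v *\<^sub>R \<xi> x))) (at x)"
    by (rule has_derivative_transform_within_open[OF _ open_S x]) (simp add: \<phi>_\<phi>)
  have "D\<phi> u (\<phi> x v) + \<phi> x (D\<phi> u v) = 0 + (\<eta> x v *\<^sub>R D\<xi> u + D\<eta> u v *\<^sub>R \<xi> x)"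
    by (rule fun_cong[OF has_derivative_unique[OF D D']])
  then show ?thesis
    by (simp add: \<phi>_\<phi>[OF x] \<eta>_eq[OF x] D\<eta>_eq lin_\<phi>_simps linear_christoffel(1)[THEN linear_add]
        linear_christoffel(1)[THEN linear_neg] linear_christoffel(1)[THEN linear_diff]
        linear_christoffel(1)[THEN linear_cmul] algebra_simps)
qed

lemma codiff_\<Phi>: "codiff g (\<lambda>y vs. g y (vs ! 0) (\<phi> y (vs ! 1))) x [v] = 0"
proof -
  define E where "E = (SOME E. orthonormal_basis (g x) E)"
  have E: "orthonormal_basis (g x) E"
    unfolding E_def using orthonormal_basis_exists by (rule someI_ex)
  have "(\<Sum>e\<in>E. g x e (B e v)) = 0"
  proof (rule trace_eq_0[OF E, where F = "\<phi> x" and N = "\<lambda>u. N u" and \<xi> = "\<xi> x"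
        and B = "\<lambda>u v. B u v"])
    show "\<phi> x (\<phi> x u) = - u + g x (\<xi> x) u *\<^sub>R \<xi> x" for u
      by (simp add: \<phi>_\<phi> \<eta>_eq x)
    show "g x (\<xi> x) (\<xi> x) = 1" using \<eta>_\<xi> \<eta>_eq x by simp
  qed (fact \<phi>_skew[OF x] \<phi>_\<xi>[OF x] linear_B linear_N N_sym N_\<xi> B_\<phi> B_\<xi> B_skew B_cyclic)+
  then show ?thesis
    unfolding codiff_def E_def[symmetric] cov_deriv_\<Phi> by simp
qed

end

lemma laplacian_\<Phi>:
  assumes "x \<in> S" "length vs = 2"
  shows "hodge_laplacian g (\<lambda>y vs. g y (vs ! 0) (\<phi> y (vs ! 1))) x vs = 0"
proof -
  let ?\<Phi> = "\<lambda>y vs. g y (vs ! 0) (\<phi> y (vs ! 1))"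
  have "dderiv (\<lambda>y. codiff g ?\<Phi> y us) x = (\<lambda>u. 0)" if "length us = 1" for us
    using that codiff_\<Phi> by (intro dderiv_eq_0[OF open_S assms(1)]) (auto simp: length_Suc_conv)
  then have "ext_deriv (codiff g ?\<Phi>) x vs = 0"
    using assms(2) by (simp add: ext_deriv_def)
  \<comment> \<open>\<open>cov_deriv\<close> involves \<open>d\<Phi>\<close> only through its
    derivative and its values at \<open>x\<close>. The lists have length 3, as the trace in
    \<open>codiff\<close> prepends one vector to \<open>vs\<close>.\<close>
  moreover have "cov_deriv g (ext_deriv ?\<Phi>) x u us = 0" if "length us = 3" for u us
  proof -
    have "dderiv (\<lambda>y. ext_deriv ?\<Phi> y us) x = (\<lambda>u. 0)"
      by (rule dderiv_eq_0[OF open_S assms(1)]) (rule closed_\<Phi>[OF _ that])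
    then show ?thesis
      using closed_\<Phi>[OF assms(1)] that by (simp add: cov_deriv_def)
  qed
  then have "codiff g (ext_deriv ?\<Phi>) x vs = 0"
    using assms(2) by (simp add: codiff_def)
  ultimately show ?thesis by (simp add: hodge_laplacian_def)
qed

end

section \<open>From the manifold to its charts\<close>

lemma smooth_on_differentiable_at:
  assumes "smooth_on UNIV S f" "open S" "x \<in> S"
  shows "f differentiable at x"
proof -
  have "k_smooth_on (Suc 0) UNIV S f" using assms(1) unfolding smooth_on_def by blast
  then show ?thesis
    using assms(2,3) by (simp add: differentiable_on_eq_differentiable_at)
qed

lemma linear_over_UNIV: "linear_over UNIV f \<longleftrightarrow> linear f"
proof
  assume f: "linear_over UNIV f"
  show "linear f"
  proof (rule linearI)
    show "f (u + v) = f u + f v" for u v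
      using f unfolding linear_over_def by (metis UNIV_I scaleR_one)
    show "f (r *\<^sub>R v) = r *\<^sub>R f v" for r v
      using f unfolding linear_over_def by (metis UNIV_I add.right_neutral scaleR_zero_left)
  qed
qed (simp add: linear_over_def linear_add linear_cmul)

lemma almost_cosymplectic_rep_chart:
  fixes A :: "('a, 'e::euclidean_space) chart set"
  assumes M: "almost_cosymplectic_manifold T A \<phi> \<xi> \<eta> g" and c: "c \<in> A"
  shows "almost_cosymplectic_rep (chart_image c) (g c) (\<phi> c) (\<xi> c) (\<eta> c)"
proof -
  note M = M[unfolded almost_cosymplectic_manifold_def almost_contact_metric_manifold_def]
  have S: "open (chart_image c)"
    using M c unfolding smooth_manifold_def by simp
  note diff = smooth_on_differentiable_at[OF _ S]
  have g: "riemannian_metric UNIV A g" and \<phi>: "endo_field UNIV A \<phi>" and \<xi>: "vector_field UNIV A \<xi>"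
    and \<eta>: "one_form UNIV A \<eta>"
    using M by blast+
  show ?thesis
  proof (rule almost_cosymplectic_rep.intro)
    show "open (chart_image c)" by (fact S)
    fix y u v :: 'e assume y: "y \<in> chart_image c"
    show "inner_form (g c y)"
      using g c y unfolding riemannian_metric_def
      by (intro inner_form.intro) (auto simp: linear_over_UNIV)
    show "(\<lambda>y. g c y u v) differentiable at y"
      using g c y unfolding riemannian_metric_def by (auto intro!: diff)
    show "linear (\<phi> c y)" "(\<lambda>y. \<phi> c y u) differentiable at y"
      using \<phi> c y unfolding endo_field_def by (auto simp: linear_over_UNIV intro!: diff)
    show "\<xi> c differentiable at y"
      using \<xi> c y unfolding vector_field_def by (auto intro!: diff)
    show "linear (\<eta> c y)" "(\<lambda>y. \<eta> c y u) differentiable at y"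
      using \<eta> c y unfolding one_form_def by (auto simp: linear_over_UNIV intro!: diff)
    show "\<eta> c y (\<xi> c y) = 1" "\<phi> c y (\<phi> c y u) = - u + \<eta> c y u *\<^sub>R \<xi> c y"
      "g c y (\<phi> c y u) (\<phi> c y v) = g c y u v - \<eta> c y u * \<eta> c y v"
      using M c y by blast+
  next
    fix y and vs :: "'e list" assume y: "y \<in> chart_image c"
    show "ext_deriv (\<lambda>y vs. g c y (vs ! 0) (\<phi> c y (vs ! 1))) y vs = 0" if "length vs = 3"
      using M c y that by (simp add: closed_form_def fundamental_form_def[abs_def])
    show "ext_deriv (\<lambda>y vs. \<eta> c y (vs ! 0)) y vs = 0" if "length vs = 2"
      using M c y that by (simp add: closed_form_def form_of_covector_def[abs_def])
  qed
qed

theorem proposition5p3: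
  fixes T :: "'a topology" and A :: "('a, 'e::euclidean_space) chart set"
    and \<phi> :: "('a, 'e) endo_fam" and \<xi> :: "('a, 'e) vector_fam"
    and \<eta> :: "('a, 'e) covector_fam" and g :: "('a, 'e) metric_fam"
  assumes "almost_cosymplectic_manifold T A \<phi> \<xi> \<eta> g"
    and "has_kaehler_leaves T A \<phi> \<eta> g"
  shows "harmonic_form A g 2 (fundamental_form g \<phi>)"
  using almost_cosymplectic_rep.laplacian_\<Phi>[OF almost_cosymplectic_rep_chart[OF assms(1)]]
  by (simp add: harmonic_form_def fundamental_form_def[abs_def])

end
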